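(* Let $n$ be a positive integer. Let $B$ be a point in the polar sector $0\le\theta\le\frac{\pi}{2n}$ of the sinusoidal spiral $r^n=\cos(n\theta)$ and let $B'$ be its radial projection onto the policle $r^4=\frac{n\sin^2(n\theta)}{1-\cos^{2n}(n\theta)}$. Let $C$ be the point on this polar sector of the sinusoidal spiral such that $\overline{OC}=\overline{OB}^{\,n}$. Then $$l=2a\sqrt{n},$$ where $l$ is the arc length of the sinusoidal spiral from $C$ to $P=(1,0)$ and $a$ denotes the area of the policular sector $OPB'$.
   Context: Here $(r,\theta)$ are polar coordinates in the plane, $r\ge 0$, $O$ is the origin, and $\overline{XY}$ denotes the distance between points $X$ and $Y$. The part of the sinusoidal spiral in the polar sector $0\le\theta\le\frac{\pi}{2n}$ is the curve $r=(\cos(n\theta))^{1/n}$, $0\le\theta\le\frac{\pi}{2n}$; the arc length from $C$ to $P$ is measured along this part. The policle is the curve with polar equation $r^4=\frac{n\sin^2(n\theta)}{1-\cos^{2n}(n\theta)}$, where at angles with $\sin(n\theta)=0$ the right-hand side is understood as its limiting value $1$ (so $P=(1,0)$ lies on the policle). If $B$ has polar angle $\alpha\in[0,\frac{\pi}{2n}]$, its radial projection $B'$ is the point of the policle on the ray $\theta=\alpha$ from $O$ (for $B=O$ one takes $\alpha=\frac{\pi}{2n}$). The policular sector $OPB'$ is the region bounded by the segments $OP$, $OB'$ and the arc of the policle over $0\le\theta\le\alpha$, i.e. the set of points with polar angle in $[0,\alpha]$ lying between $O$ and the policle. *)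

theory Defs
  imports "HOL-Analysis.Analysis"
begin

text \<open>The plane is \<^typ>\<open>complex\<close>; \<^term>\<open>rcis r \<theta>\<close> is the point with polar coordinates
  \<open>(r, \<theta>)\<close>, the origin \<open>O\<close> is \<open>0\<close> and \<open>P\<close> is \<open>1\<close>.\<close>

text \<open>Length of the curve \<open>g\<close> over \<open>{a..b}\<close>: the supremum of the lengths of the inscribed
  polygons, infinite if the curve is not rectifiable.\<close>

definition curve_length :: "(real \<Rightarrow> 'a::metric_space) \<Rightarrow> real \<Rightarrow> real \<Rightarrow> ennreal" where
  "curve_length g a b =
     (SUP ts \<in> {ts. sorted ts \<and> set ts \<subseteq> {a..b}}.
        \<Sum>i<length ts - 1. ennreal (dist (g (ts ! i)) (g (ts ! Suc i))))"

text \<open>The point of the sinusoidal spiral at polar angle \<open>\<theta>\<close>; meaningful where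
  \<open>cos (n \<theta>) \<ge> 0\<close>, in particular on \<open>{0..pi / (2 * n)}\<close>.\<close>

definition spiral :: "nat \<Rightarrow> real \<Rightarrow> complex" where
  "spiral n \<theta> = rcis (root n (cos (real n * \<theta>))) \<theta>"

text \<open>The \<open>if\<close> extends the right-hand side to \<open>sin (n \<theta>) = 0\<close> by its limit \<open>1\<close>.\<close>

definition policle :: "nat \<Rightarrow> complex set" where
  "policle n =
     {rcis r \<theta> | r \<theta>. 0 \<le> r \<and>
        r ^ 4 = (if sin (real n * \<theta>) = 0 then 1
                 else real n * (sin (real n * \<theta>))\<^sup>2 / (1 - cos (real n * \<theta>) ^ (2 * n)))}"

text \<open>The union of the segments from \<open>O\<close> to the points of the policle whose polar angle lies
  between \<open>0\<close> and that of \<open>B'\<close>. The policle does not pass through \<open>O\<close>, so the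
  convention \<open>Arg 0 = 0\<close> plays no role. The sector is used only for \<open>B'\<close> with polar angle in
  \<open>[0, \<pi>/2]\<close>, where \<^const>\<open>Arg\<close> is the polar angle.\<close>

definition policular_sector :: "nat \<Rightarrow> complex \<Rightarrow> complex set" where
  "policular_sector n B' =
     {z. \<exists>w\<in>policle n. 0 \<le> Arg w \<and> Arg w \<le> Arg B' \<and> z \<in> closed_segment 0 w}"

end

theory Submission
  imports Defs
begin

text \<open>
  Write \<open>S x = (\<Sum>k<n. x ^ (2 * k))\<close>, so that \<open>(1 - x\<^sup>2) * S x = 1 - x ^ (2 * n)\<close>. Both sides of the theorem
  are the integral of \<open>1 / sqrt (1 - x ^ (2 * n))\<close> over \<open>x\<close> from \<open>cos (n \<alpha>)\<close> to \<open>1\<close>.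

  For the area, cancelling \<open>(sin (n \<theta>))\<^sup>2\<close> in the equation of the policle leaves
  \<open>r ^ 4 = n / S (cos (n \<theta>))\<close>. Twice the area of the sector is the integral of \<open>r\<^sup>2\<close> over \<open>{0..\<alpha>}\<close>
  (\<open>has_integral_measure_polar_sector\<close>), so \<open>2 * a * sqrt n\<close> is the integral of
  \<open>n / sqrt (S (cos (n \<theta>)))\<close>; the substitution \<open>x = cos (n \<theta>)\<close> gives the integral above.

  For the length, the speed of the spiral with respect to the polar angle is \<open>1 / \<rho> ^ (n - 1)\<close>, where
  \<open>\<rho> ^ n = cos (n \<theta>)\<close>, and the substitution \<open>x = \<rho>\<close> gives the same integral from \<open>cmod C\<close> to \<open>1\<close>.
  The hypothesis on \<open>B\<close> and \<open>C\<close> says that \<open>cmod C = cos (n \<alpha>)\<close>.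

  The integrand in \<open>x\<close> is singular at \<open>1\<close>, so the proof never leaves the polar angles, where
  \<open>n / sqrt (S (cos (n \<theta>)))\<close> is continuous: \<open>policle_angle\<close> sends the polar angle of \<open>C\<close> to that of \<open>B\<close>,
  and the area integral up to this angle, as a function of the polar angle of \<open>C\<close>, has the speed of
  the spiral as its derivative (\<open>spiral_length_derivative\<close>). That such a function measures the length
  is \<open>curve_length_eq_antiderivative_of_speed\<close>, whose assumptions tolerate that
  this speed is unbounded near \<open>O\<close>.
\<close>

section \<open>The length of a curve as the integral of its speed\<close>

definition polygon_length :: "(real \<Rightarrow> 'a::metric_space) \<Rightarrow> real list \<Rightarrow> real" where
  "polygon_length g ts = (\<Sum>i<length ts - 1. dist (g (ts ! i)) (g (ts ! Suc i)))"

lemma polygon_length_simps: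
  "polygon_length g [] = 0"
  "polygon_length g [x] = 0"
  "polygon_length g (x # y # ts) = dist (g x) (g y) + polygon_length g (y # ts)"
  by (simp_all add: polygon_length_def sum.lessThan_Suc_shift del: sum.lessThan_Suc)

lemma polygon_length_nonneg: "0 \<le> polygon_length g ts"
  by (simp add: polygon_length_def sum_nonneg)

text \<open>Joining two polygons adds the edge between them.\<close>

lemma polygon_length_append:
  "polygon_length g ts + polygon_length g us \<le> polygon_length g (ts @ us)"
proof (induction ts rule: induct_list012)
  case (2 x)
  then show ?case by (cases us) (simp_all add: polygon_length_simps)
qed (simp_all add: polygon_length_simps)

lemma curve_length_conv_polygon_length:
  "curve_length g a b =
     (SUP ts \<in> {ts. sorted ts \<and> set ts \<subseteq> {a..b}}. ennreal (polygon_length g ts))"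
  by (simp add: curve_length_def polygon_length_def)

text \<open>If \<open>L\<close> dominates every chord, the edges of a polygon telescope against the increments
  of \<open>L\<close>.\<close>

lemma polygon_length_le:
  assumes bound: "\<And>s t. a \<le> s \<Longrightarrow> s \<le> t \<Longrightarrow> t \<le> b \<Longrightarrow> dist (g s) (g t) \<le> L t - (L s :: real)"
    and "sorted ts" "set ts \<subseteq> {a..b}" "a \<le> b"
  shows "polygon_length g ts \<le> L b - L a"
proof -
  have aux: "sorted (x # ts) \<Longrightarrow> set (x # ts) \<subseteq> {a..b} \<Longrightarrow> polygon_length g (x # ts) \<le> L b - L x" for x ts
  proof (induction ts arbitrary: x)
    case Nil
    then have "dist (g x) (g b) \<le> L b - L x" by (intro bound) auto
    then have "0 \<le> L b - L x" by (rule order_trans[OF zero_le_dist])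
    then show ?case by (simp add: polygon_length_simps)
  next
    case (Cons y ts)
    then have "dist (g x) (g y) \<le> L y - L x" by (intro bound) auto
    with Cons.IH[of y] Cons.prems show ?case by (simp add: polygon_length_simps)
  qed
  show ?thesis
  proof (cases ts)
    case Nil
    then show ?thesis
      using order_trans[OF zero_le_dist bound[of a b]] \<open>a \<le> b\<close> by (simp add: polygon_length_simps)
  next
    case (Cons x us)
    have "dist (g a) (g x) \<le> L x - L a" using assms Cons by (intro bound) auto
    then have "L a \<le> L x" using zero_le_dist[of "g a" "g x"] by linarith
    then show ?thesis using aux[of x us] assms Cons by simp
  qed
qed

text \<open>Near a point \<open>x\<close> both \<open>g\<close> and \<open>L\<close> are linear up to a small relative error, so the single
  chord over a short interval \<open>{s..t}\<close> around \<open>x\<close> is at least \<open>L t - L s - e * (t - s)\<close>. This lower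
  bound survives concatenation of polygons, and compactness of the interval (in the form
  of \<open>Bolzano\<close>) turns the local bound into a global one.\<close>

lemma ex_polygon_almost_length:
  fixes g :: "real \<Rightarrow> 'a::real_normed_vector" and L :: "real \<Rightarrow> real"
  assumes "c \<le> d" "e > 0"
    and g': "\<And>x. c \<le> x \<Longrightarrow> x \<le> d \<Longrightarrow> (g has_vector_derivative g' x) (at x)"
    and L': "\<And>x. c \<le> x \<Longrightarrow> x \<le> d \<Longrightarrow> (L has_real_derivative norm (g' x)) (at x)"
  shows "\<exists>ts. sorted ts \<and> set ts \<subseteq> {c..d} \<and> L d - L c - e * (d - c) \<le> polygon_length g ts"
    (is "?P c d")
  using \<open>c \<le> d\<close>
proof (induction rule: Bolzano)
  case (trans p q r)
  then obtain ts us where ts: "sorted ts" "set ts \<subseteq> {p..q}" "L q - L p - e * (q - p) \<le> polygon_length g ts"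
    and us: "sorted us" "set us \<subseteq> {q..r}" "L r - L q - e * (r - q) \<le> polygon_length g us"
    by blast
  have "sorted (ts @ us)"
    using ts us by (auto simp: sorted_append subset_iff intro: order_trans)
  moreover have "set (ts @ us) \<subseteq> {p..r}"
    using ts us trans by (auto simp: subset_iff intro: order_trans)
  moreover have "L r - L p - e * (r - p) \<le> polygon_length g (ts @ us)"
    using polygon_length_append[of g ts us] ts us by (simp add: algebra_simps)
  ultimately show ?case by blast
next
  case (local x)
  have "e / 2 > 0" using \<open>e > 0\<close> by simp
  then obtain d1 where d1: "d1 > 0"
    "\<And>y. norm (y - x) < d1 \<Longrightarrow> norm (g y - g x - (y - x) *\<^sub>R g' x) \<le> e / 2 * norm (y - x)"
    using g'[OF local] unfolding has_vector_derivative_def has_derivative_at_alt by meson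
  obtain d2 where d2: "d2 > 0"
    "\<And>y. norm (y - x) < d2 \<Longrightarrow> norm (L y - L x - norm (g' x) * (y - x)) \<le> e / 2 * norm (y - x)"
    using L'[OF local] \<open>e / 2 > 0\<close> unfolding has_field_derivative_def has_derivative_at_alt by meson
  show ?case
  proof (intro exI[of _ "min d1 d2"] conjI allI impI)
    show "min d1 d2 > 0" using d1 d2 by simp
    fix s t assume st: "s \<le> x \<and> x \<le> t \<and> t - s < min d1 d2"
    have 1: "norm (g t - g x - (t - x) *\<^sub>R g' x) \<le> e / 2 * (t - x)"
      using d1(2)[of t] st by simp
    have 2: "norm (g s - g x - (s - x) *\<^sub>R g' x) \<le> e / 2 * (x - s)"
      using d1(2)[of s] st by simp
    have 3: "\<bar>L t - L x - norm (g' x) * (t - x)\<bar> \<le> e / 2 * (t - x)"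
      using d2(2)[of t] st by simp
    have 4: "\<bar>L s - L x - norm (g' x) * (s - x)\<bar> \<le> e / 2 * (x - s)"
      using d2(2)[of s] st by simp
    have "(t - s) *\<^sub>R g' x = (g t - g s) - (g t - g x - (t - x) *\<^sub>R g' x) + (g s - g x - (s - x) *\<^sub>R g' x)"
      by (simp add: algebra_simps)
    then have "norm ((t - s) *\<^sub>R g' x) \<le> norm (g t - g s) + norm (g t - g x - (t - x) *\<^sub>R g' x)
        + norm (g s - g x - (s - x) *\<^sub>R g' x)"
      by (simp only:) (intro norm_triangle_le add_mono norm_triangle_ineq4 order_refl)
    then have "(t - s) * norm (g' x) \<le> dist (g s) (g t) + e / 2 * (t - x) + e / 2 * (x - s)"
      using 1 2 st by (simp add: dist_norm norm_minus_commute)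
    moreover have "L t - L s \<le> (t - s) * norm (g' x) + e / 2 * (t - x) + e / 2 * (x - s)"
    proof -
      have "(t - s) * norm (g' x) = norm (g' x) * (t - x) - norm (g' x) * (s - x)"
        by (simp add: algebra_simps)
      then show ?thesis using 3 4 unfolding abs_le_iff by linarith
    qed
    ultimately have "L t - L s - e * (t - s) \<le> polygon_length g [s, t]"
      by (simp add: polygon_length_simps field_simps)
    then show "?P s t" using st by (intro exI[of _ "[s, t]"]) auto
  qed
qed

text \<open>The derivatives live on the open interval because the speed of the spiral in terms of the
  polar angle is unbounded near \<open>O\<close> as soon as \<open>n \<ge> 2\<close>. The upper bound is the mean value inequality on each chord; the lower bound comes from
  inscribed polygons over inner intervals, which are then pushed to the end points by the
  continuity of \<open>L\<close>.\<close>

theorem curve_length_eq_antiderivative_of_speed: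
  fixes g :: "real \<Rightarrow> 'a::real_normed_vector" and L :: "real \<Rightarrow> real"
  assumes "a \<le> b"
    and g: "continuous_on {a..b} g" and L: "continuous_on {a..b} L"
    and g': "\<And>x. a < x \<Longrightarrow> x < b \<Longrightarrow> (g has_vector_derivative g' x) (at x)"
    and L': "\<And>x. a < x \<Longrightarrow> x < b \<Longrightarrow> (L has_real_derivative norm (g' x)) (at x)"
  shows "curve_length g a b = ennreal (L b - L a)"
proof -
  have chord: "dist (g s) (g t) \<le> L t - L s" if "a \<le> s" "s \<le> t" "t \<le> b" for s t
  proof (cases "s = t")
    case False
    then have "norm (g t - g s) \<le> L t - L s"
      using that
      by (intro differentiable_bound_general[where f' = g' and \<phi>' = "\<lambda>x. norm (g' x)"])
        (auto intro: continuous_on_subset[OF g] continuous_on_subset[OF L] g'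
           L'[unfolded has_real_derivative_iff_has_vector_derivative])
    then show ?thesis by (simp add: dist_norm norm_minus_commute)
  qed simp
  have upper: "curve_length g a b \<le> ennreal (L b - L a)"
    unfolding curve_length_conv_polygon_length
  proof (rule SUP_least)
    fix ts assume "ts \<in> {ts. sorted ts \<and> set ts \<subseteq> {a..b}}"
    then have "polygon_length g ts \<le> L b - L a"
      using polygon_length_le[of a b g L ts] chord \<open>a \<le> b\<close> by simp
    then show "ennreal (polygon_length g ts) \<le> ennreal (L b - L a)" by (rule ennreal_leI)
  qed
  then obtain l where l: "l \<ge> 0" "curve_length g a b = ennreal l"
    by (cases "curve_length g a b" rule: ennreal_cases) (auto simp: top_unique)
  have poly_le: "polygon_length g ts \<le> l" if "sorted ts" "set ts \<subseteq> {a..b}" for ts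
  proof -
    have "ennreal (polygon_length g ts) \<le> curve_length g a b"
      unfolding curve_length_conv_polygon_length using that by (intro SUP_upper) auto
    then show ?thesis using l by (simp add: polygon_length_nonneg)
  qed
  have inner: "L d - L c \<le> l" if cd: "a < c" "c \<le> d" "d < b" for c d
  proof (rule field_le_epsilon)
    fix e :: real assume "e > 0"
    \<comment> \<open>The \<open>+ 1\<close> keeps the quotient meaningful when \<open>c = d\<close>.\<close>
    define \<epsilon> where "\<epsilon> = e / (d - c + 1)"
    have "\<epsilon> > 0" using \<open>e > 0\<close> cd by (simp add: \<epsilon>_def)
    then obtain ts where ts: "sorted ts" "set ts \<subseteq> {c..d}" "L d - L c - \<epsilon> * (d - c) \<le> polygon_length g ts"
      using ex_polygon_almost_length[of c d \<epsilon> g g' L] g' L' cd by force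
    have "polygon_length g ts \<le> l" using ts cd by (intro poly_le) auto
    moreover have "\<epsilon> * (d - c) \<le> e" using \<open>e > 0\<close> cd by (simp add: \<epsilon>_def field_simps)
    ultimately show "L d - L c \<le> l + e" using ts by linarith
  qed
  have "L b - L a \<le> l"
  proof (cases "a = b")
    case False
    with \<open>a \<le> b\<close> have "a < b" by simp
    have left: "L d - L a \<le> l" if "a < d" "d < b" for d
      by (rule continuous_le_on_closure[of "{a<..<d}" "\<lambda>c. L d - L c"])
        (use that inner in \<open>auto intro!: continuous_intros continuous_on_subset[OF L]\<close>)
    show ?thesis
      by (rule continuous_le_on_closure[of "{a<..<b}" "\<lambda>d. L d - L a"])
        (use \<open>a < b\<close> left in \<open>auto intro!: continuous_intros continuous_on_subset[OF L]\<close>)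
  qed (use l in simp)
  then have "ennreal (L b - L a) \<le> curve_length g a b" unfolding l by (rule ennreal_leI)
  with upper show ?thesis by (rule antisym)
qed


section \<open>The area of a sector bounded by a polar curve\<close>

definition polar_sector :: "(real \<Rightarrow> real) \<Rightarrow> real \<Rightarrow> real \<Rightarrow> complex set" where
  "polar_sector R s t = {rcis r \<theta> | r \<theta>. s \<le> \<theta> \<and> \<theta> \<le> t \<and> 0 \<le> r \<and> r \<le> R \<theta>}"

lemma polar_sectorI:
  "z = rcis r \<theta> \<Longrightarrow> s \<le> \<theta> \<Longrightarrow> \<theta> \<le> t \<Longrightarrow> 0 \<le> r \<Longrightarrow> r \<le> R \<theta> \<Longrightarrow> z \<in> polar_sector R s t"
  by (auto simp: polar_sector_def)

lemma polar_sectorE: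
  assumes "z \<in> polar_sector R s t"
  obtains r \<theta> where "z = rcis r \<theta>" "s \<le> \<theta>" "\<theta> \<le> t" "0 \<le> r" "r \<le> R \<theta>"
  using assms by (auto simp: polar_sector_def)

text \<open>Measuring the radius in units of \<open>R \<theta>\<close> exhibits a sector as the continuous image of a
  rectangle. Compactness is what makes sectors measurable.\<close>

lemma compact_polar_sector:
  assumes R: "continuous_on {s..t} R" and nn: "\<And>\<theta>. \<theta> \<in> {s..t} \<Longrightarrow> 0 \<le> R \<theta>"
  shows "compact (polar_sector R s t)"
proof -
  have "polar_sector R s t = (\<lambda>(u, \<theta>). rcis (u * R \<theta>) \<theta>) ` ({0..1} \<times> {s..t})" (is "_ = ?I")
  proof (intro equalityI subsetI)
    fix z assume "z \<in> polar_sector R s t"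
    then obtain r \<theta> where z: "z = rcis r \<theta>" "s \<le> \<theta>" "\<theta> \<le> t" "0 \<le> r" "r \<le> R \<theta>"
      by (blast elim: polar_sectorE)
    then have "z = (\<lambda>(u, \<theta>). rcis (u * R \<theta>) \<theta>) (r / R \<theta>, \<theta>)" "r / R \<theta> \<in> {0..1}"
      by (auto simp: divide_le_eq)
    then show "z \<in> ?I" using z by (intro image_eqI[where x = "(r / R \<theta>, \<theta>)"]) auto
  next
    fix z assume "z \<in> ?I"
    then obtain u \<theta> where "z = rcis (u * R \<theta>) \<theta>" "0 \<le> u" "u \<le> 1" "s \<le> \<theta>" "\<theta> \<le> t" by auto
    then show "z \<in> polar_sector R s t"
      using nn[of \<theta>] mult_left_le_one_le[of "R \<theta>" u]
      by (intro polar_sectorI[where r = "u * R \<theta>" and \<theta> = \<theta>]) auto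
  qed
  moreover have "compact ?I"
    using R
    by (intro compact_continuous_image compact_Times)
       (auto simp: case_prod_beta intro!: continuous_intros elim: continuous_on_compose2)
  ultimately show ?thesis by simp
qed

lemma negligible_polar_line: "negligible {z. cos t * Im z = sin t * Re z}"
proof -
  have "Complex (- sin t) (cos t) \<noteq> 0"
    using sin_zero_abs_cos_one[of t] by (auto simp: complex_eq_iff)
  then have "negligible {z. Complex (- sin t) (cos t) \<bullet> z = 0}"
    by (intro negligible_hyperplane) simp
  moreover have "{z. cos t * Im z = sin t * Re z} = {z. Complex (- sin t) (cos t) \<bullet> z = 0}"
    by (auto simp: inner_complex_def)
  ultimately show ?thesis by simp
qed

lemma polar_sector_Un:
  "s \<le> t \<Longrightarrow> t \<le> u \<Longrightarrow> polar_sector R s t \<union> polar_sector R t u = polar_sector R s u"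
  unfolding polar_sector_def by (auto intro: order_trans) (metis linear order_trans)

text \<open>Two polar representations of one nonzero point differ by a multiple of \<open>2 * pi\<close>, so
  adjacent sectors that together span at most a full turn meet only along the ray at \<open>t\<close>, or along
  the ray at \<open>s\<close> when they close up to a full turn. The full turn must be allowed because the disc
  serves to normalise the area of circular sectors.\<close>

lemma negligible_polar_sector_Int:
  assumes "u \<le> s + 2 * pi"
  shows "negligible (polar_sector R s t \<inter> polar_sector R t u)"
proof (rule negligible_subset)
  show "negligible ({z. cos t * Im z = sin t * Re z} \<union> {z. cos s * Im z = sin s * Re z})"
    by (intro negligible_Un negligible_polar_line)
  show "polar_sector R s t \<inter> polar_sector R t u
      \<subseteq> {z. cos t * Im z = sin t * Re z} \<union> {z. cos s * Im z = sin s * Re z}"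
  proof
    fix z assume "z \<in> polar_sector R s t \<inter> polar_sector R t u"
    then obtain r \<theta> r' \<theta>' where z: "z = rcis r \<theta>" "s \<le> \<theta>" "\<theta> \<le> t" "0 \<le> r"
        and z': "z = rcis r' \<theta>'" "t \<le> \<theta>'" "\<theta>' \<le> u" "0 \<le> r'"
      by (blast elim: polar_sectorE)
    show "z \<in> {z. cos t * Im z = sin t * Re z} \<union> {z. cos s * Im z = sin s * Re z}"
    proof (cases "r = 0")
      case True
      then show ?thesis using z by simp
    next
      case False
      have "r = r'" using z z' by (metis abs_of_nonneg complex_mod_rcis)
      with False z z' have "cis \<theta> = cis \<theta>'" by (simp add: rcis_def)
      then have "cis (\<theta>' - \<theta>) = 1" by (simp flip: cis_divide)
      then have "cos (\<theta>' - \<theta>) = 1" by (simp add: complex_eq_iff)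
      then obtain k :: int where k: "\<theta>' - \<theta> = k * 2 * pi" by (auto simp: cos_one_2pi_int)
      have "k \<ge> 0"
      proof (rule ccontr)
        assume "\<not> k \<ge> 0"
        then have "k * (2 * pi) < 0" by (simp add: mult_neg_pos)
        then have "\<theta>' < \<theta>" using k by linarith
        then show False using z z' by simp
      qed
      moreover have "k \<le> 1"
      proof (rule ccontr)
        assume "\<not> k \<le> 1"
        then have "1 * (2 * pi) < k * (2 * pi)" by (intro mult_strict_right_mono) auto
        then have "\<theta>' - \<theta> > 2 * pi" using k by (simp add: mult.assoc)
        then show False using z z' assms by simp
      qed
      ultimately have "k = 0 \<or> k = 1" by auto
      then have "\<theta> = t \<or> \<theta> = s" using k z z' assms by auto
      then show ?thesis using z by auto
    qed
  qed
qed

lemma measure_polar_sector_split: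
  assumes R: "continuous_on {s..u} R" and nn: "\<And>\<theta>. \<theta> \<in> {s..u} \<Longrightarrow> 0 \<le> R \<theta>"
    and "s \<le> t" "t \<le> u" "u \<le> s + 2 * pi"
  shows "measure lebesgue (polar_sector R s u) =
    measure lebesgue (polar_sector R s t) + measure lebesgue (polar_sector R t u)"
proof -
  have "polar_sector R s t \<in> lmeasurable" "polar_sector R t u \<in> lmeasurable"
    using assms by (auto intro!: lmeasurable_compact compact_polar_sector continuous_on_subset[OF R])
  then have "measure lebesgue (polar_sector R s t \<union> polar_sector R t u) =
      measure lebesgue (polar_sector R s t) + measure lebesgue (polar_sector R t u)"
    using negligible_imp_measure0[OF negligible_polar_sector_Int[OF \<open>u \<le> s + 2 * pi\<close>, of R t]]
    by (simp add: measure_Un3)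
  then show ?thesis using polar_sector_Un assms by simp
qed

text \<open>This identification of the plane with \<^typ>\<open>real^2\<close> carries rotation invariance of Lebesgue
  measure over from \<open>measure_orthogonal_image\<close>.\<close>

lemma lborel_complex_eq_distr:
  "(lborel :: complex measure) = distr lborel borel (\<lambda>v::real^2. Complex (v $ 1) (v $ 2))"
    (is "_ = distr _ _ ?\<phi>")
proof (rule lborel_eqI)
  have cont: "continuous_on UNIV ?\<phi>"
    unfolding Complex_eq by (intro continuous_intros)
  then have [measurable]: "?\<phi> \<in> borel_measurable borel" by (rule borel_measurable_continuous_onI)
  fix l u :: complex assume le: "\<And>b. b \<in> Basis \<Longrightarrow> l \<bullet> b \<le> u \<bullet> b"
  have eq: "?\<phi> -` box l u = box (vector [Re l, Im l]) (vector [Re u, Im u])"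
    by (auto simp: box_def Basis_complex_def Basis_vec_def forall_2 inner_axis vector_2)
  have "emeasure (distr lborel borel ?\<phi>) (box l u)
      = emeasure lborel (box (vector [Re l, Im l]) (vector [Re u, Im u] :: real^2))"
    by (simp add: emeasure_distr eq)
  also have "\<dots> = ennreal (\<Prod>b\<in>Basis. (vector [Re u, Im u] - vector [Re l, Im l] :: real^2) \<bullet> b)"
  proof (intro emeasure_lborel_box)
    fix b :: "real^2" assume "b \<in> Basis"
    then have "b = axis 1 1 \<or> b = axis 2 1" by (auto simp: Basis_vec_def) (metis exhaust_2)
    then show "vector [Re l, Im l] \<bullet> b \<le> vector [Re u, Im u] \<bullet> b"
      using le[of 1] le[of \<i>] by (auto simp: Basis_complex_def inner_axis vector_2)
  qed
  also have "(\<Prod>b\<in>Basis. (vector [Re u, Im u] - vector [Re l, Im l] :: real^2) \<bullet> b) = (\<Prod>b\<in>Basis. (u - l) \<bullet> b)"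
  proof -
    have basis: "(Basis :: (real^2) set) = {axis 1 1, axis 2 1}"
      by (auto simp: Basis_vec_def UNIV_2)
    have "prod f Basis = f (axis 1 1) * f (axis 2 1)" for f :: "real^2 \<Rightarrow> real"
      unfolding basis by (simp add: axis_eq_axis)
    then show ?thesis by (simp add: Basis_complex_def inner_axis)
  qed
  finally show "emeasure (distr lborel borel ?\<phi>) (box l u) = ennreal (\<Prod>b\<in>Basis. (u - l) \<bullet> b)" .
qed simp

lemma measure_rotate_compact:
  fixes K :: "complex set"
  assumes "compact K"
  shows "measure lebesgue ((*) (cis v) ` K) = measure lebesgue K"
proof -
  define \<phi> where "\<phi> = (\<lambda>v::real^2. Complex (v $ 1) (v $ 2))"
  define \<psi> where "\<psi> = (\<lambda>z. vector [Re z, Im z] :: real^2)"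
  have inv [simp]: "\<phi> (\<psi> z) = z" "\<psi> (\<phi> w) = w" for z w
    by (auto simp: \<phi>_def \<psi>_def vector_2 vec_eq_iff forall_2)
  have lin: "linear \<phi>" "linear \<psi>"
    by (auto simp: \<phi>_def \<psi>_def linear_iff complex_eq_iff vec_eq_iff forall_2 vector_2)
  have norm: "norm (\<phi> w) = norm w" for w
    by (simp add: \<phi>_def norm_vec_def L2_set_def sum_2 cmod_def)
  have \<phi>_meas: "\<phi> \<in> borel_measurable borel"
    using linear_continuous_on[OF linear_conv_bounded_linear[THEN iffD1, OF lin(1)]]
    by (rule borel_measurable_continuous_onI)
  have meas: "measure lebesgue S = measure lebesgue (\<psi> ` S)" if "compact S" for S
  proof -
    have eq: "\<phi> -` S = \<psi> ` S" by (auto simp: image_iff) (metis inv)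
    have [measurable]: "S \<in> sets borel" using that by (simp add: compact_imp_closed)
    have c: "compact (\<psi> ` S)"
      using that lin linear_conv_bounded_linear linear_continuous_on compact_continuous_image by metis
    have "measure lebesgue S = measure (distr lborel borel \<phi>) S"
      by (simp flip: lborel_complex_eq_distr[folded \<phi>_def])
    also have "\<dots> = measure lborel (\<psi> ` S)"
      using \<phi>_meas by (simp add: measure_distr eq)
    also have "\<dots> = measure lebesgue (\<psi> ` S)" using c by (simp add: compact_imp_closed)
    finally show ?thesis .
  qed
  define \<rho> where "\<rho> = \<psi> \<circ> (*) (cis v) \<circ> \<phi>"
  have norm': "norm (\<psi> z) = norm z" for z using norm[of "\<psi> z"] by simp
  have "orthogonal_transformation \<rho>"
    unfolding orthogonal_transformation \<rho>_def
    by (auto intro!: linear_compose lin simp: linear_times norm norm' norm_mult)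
  moreover have "\<psi> ` K \<in> lmeasurable"
    using assms lin linear_conv_bounded_linear linear_continuous_on compact_continuous_image lmeasurable_compact
    by metis
  ultimately have "measure lebesgue (\<rho> ` \<psi> ` K) = measure lebesgue (\<psi> ` K)"
    by (intro measure_orthogonal_image)
  moreover have "\<rho> ` \<psi> ` K = \<psi> ` (*) (cis v) ` K"
    by (simp add: \<rho>_def image_image)
  moreover have "compact ((*) (cis v) ` K)"
    using assms by (intro compact_continuous_image continuous_intros)
  ultimately show ?thesis using meas assms by simp
qed

lemma measure_circular_sector_rotate:
  assumes "0 \<le> r"
  shows "measure lebesgue (polar_sector (\<lambda>_. r) (s + v) (t + v)) = measure lebesgue (polar_sector (\<lambda>_. r) s t)"
proof -
  have "polar_sector (\<lambda>_. r) (s + v) (t + v) = (*) (cis v) ` polar_sector (\<lambda>_. r) s t"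
  proof (intro equalityI subsetI)
    fix z assume "z \<in> polar_sector (\<lambda>_. r) (s + v) (t + v)"
    then obtain p \<theta> where z: "z = rcis p \<theta>" "s + v \<le> \<theta>" "\<theta> \<le> t + v" "0 \<le> p" "p \<le> r"
      by (blast elim: polar_sectorE)
    then show "z \<in> (*) (cis v) ` polar_sector (\<lambda>_. r) s t"
      by (intro image_eqI[where x = "rcis p (\<theta> - v)"])
        (auto simp: cis_rcis_eq rcis_mult intro!: polar_sectorI)
  next
    fix z assume "z \<in> (*) (cis v) ` polar_sector (\<lambda>_. r) s t"
    then obtain p \<theta> where z: "z = rcis p (v + \<theta>)" "s \<le> \<theta>" "\<theta> \<le> t" "0 \<le> p" "p \<le> r"
      by (auto simp: cis_rcis_eq rcis_mult elim!: polar_sectorE)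
    then show "z \<in> polar_sector (\<lambda>_. r) (s + v) (t + v)"
      by (intro polar_sectorI) auto
  qed
  moreover have "compact (polar_sector (\<lambda>_. r) s t)"
    using assms by (intro compact_polar_sector) auto
  ultimately show ?thesis by (simp add: measure_rotate_compact)
qed

lemma measure_circular_sector_scale:
  assumes "0 < r"
  shows "measure lebesgue (polar_sector (\<lambda>_. r) s t) = r\<^sup>2 * measure lebesgue (polar_sector (\<lambda>_. 1) s t)"
proof -
  have "polar_sector (\<lambda>_. r) s t = (\<lambda>z. r *\<^sub>R z + 0) ` polar_sector (\<lambda>_. 1) s t"
  proof (intro equalityI subsetI)
    fix z assume "z \<in> polar_sector (\<lambda>_. r) s t"
    then obtain p \<theta> where z: "z = rcis p \<theta>" "s \<le> \<theta>" "\<theta> \<le> t" "0 \<le> p" "p \<le> r"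
      by (blast elim: polar_sectorE)
    then show "z \<in> (\<lambda>z. r *\<^sub>R z + 0) ` polar_sector (\<lambda>_. 1) s t"
      using assms
      by (intro image_eqI[where x = "rcis (p / r) \<theta>"])
        (auto simp: complex_eq_iff intro!: polar_sectorI[where r = "p / r" and \<theta> = \<theta>])
  next
    fix z assume "z \<in> (\<lambda>z. r *\<^sub>R z + 0) ` polar_sector (\<lambda>_. 1) s t"
    then obtain p \<theta> where z: "z = r *\<^sub>R rcis p \<theta>" "s \<le> \<theta>" "\<theta> \<le> t" "0 \<le> p" "p \<le> 1"
      by (auto elim!: polar_sectorE)
    moreover have "r * p \<le> r" using z assms by (simp add: mult_left_le)
    ultimately show "z \<in> polar_sector (\<lambda>_. r) s t"
      using assms
      by (intro polar_sectorI[where r = "r * p" and \<theta> = \<theta>]) (auto simp: complex_eq_iff)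
  qed
  then show ?thesis using measure_lebesgue_affine[of r 0 "polar_sector (\<lambda>_. 1) s t"] by simp
qed

lemma polar_sector_full_circle: "polar_sector (\<lambda>_. 1) 0 (2 * pi) = cball 0 1"
proof (intro equalityI subsetI)
  fix z :: complex assume "z \<in> cball 0 1"
  moreover have "z = rcis (cmod z) (Arg2pi z)" by (simp add: rcis_def cis_conv_exp flip: Arg2pi_eq)
  ultimately show "z \<in> polar_sector (\<lambda>_. 1) 0 (2 * pi)"
    using Arg2pi_ge_0[of z] Arg2pi_lt_2pi[of z]
    by (intro polar_sectorI[where r = "cmod z" and \<theta> = "Arg2pi z"]) auto
qed (auto simp: polar_sector_def)

text \<open>The area of the unit sector of angle \<open>u\<close> is additive in \<open>u\<close> (by rotation invariance),
  monotone, and equal to \<open>pi\<close> for the full turn. Additivity gives the value at the angles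
  \<open>2 * pi * k / m\<close>, and monotonicity squeezes the value at \<open>u\<close> between two neighbours of this kind.\<close>

lemma measure_unit_sector:
  assumes "0 \<le> u" "u \<le> 2 * pi"
  shows "measure lebesgue (polar_sector (\<lambda>_. 1) 0 u) = u / 2"
proof -
  define f where "f t = measure lebesgue (polar_sector (\<lambda>_. 1) 0 t)" for t
  have f_add: "f (s + t) = f s + f t" if "0 \<le> s" "0 \<le> t" "s + t \<le> 2 * pi" for s t
    using measure_polar_sector_split[of 0 "s + t" "\<lambda>_. 1" s] that
      measure_circular_sector_rotate[of 1 0 s t] by (simp add: f_def add.commute)
  have f_mono: "f s \<le> f t" if "0 \<le> s" "s \<le> t" "t \<le> 2 * pi" for s t
    using f_add[of s "t - s"] that measure_nonneg[of lebesgue "polar_sector (\<lambda>_. 1) 0 (t - s)"]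
    by (simp add: f_def)
  have f_full: "f (2 * pi) = pi"
    by (simp add: f_def polar_sector_full_circle content_cball unit_ball_vol_2)
  have f_mult: "f (real k * t) = real k * f t" if "0 \<le> t" "real k * t \<le> 2 * pi" for k t
    using that(2)
  proof (induction k)
    case 0
    then show ?case using f_add[of 0 0] by simp
  next
    case (Suc k)
    then show ?case using f_add[of "real k * t" t] \<open>0 \<le> t\<close> by (simp add: algebra_simps)
  qed
  have approx: "\<bar>f u - u / 2\<bar> \<le> pi / real m" if "m > 0" for m
  proof (cases "u = 2 * pi")
    case True
    then show ?thesis by (simp add: f_full)
  next
    case False
    with assms have "u < 2 * pi" by simp
    \<comment> \<open>\<open>u\<close> lies between the consecutive multiples \<open>k * v\<close> and \<open>(k + 1) * v\<close> of the angle \<open>v\<close>.\<close>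
    define v where "v = 2 * pi / real m"
    have "v > 0" using that by (simp add: v_def)
    have mv: "real m * v = 2 * pi" using that by (simp add: v_def)
    have fv: "f v = v / 2" using f_mult[of v m] f_full mv that \<open>v > 0\<close>
      by (simp add: v_def field_simps)
    define k where "k = nat \<lfloor>u / v\<rfloor>"
    have k: "real k \<le> u / v" "u / v < real k + 1"
      using assms \<open>v > 0\<close> by (simp_all add: k_def)
    then have k': "real k * v \<le> u" "u \<le> real (Suc k) * v"
      using \<open>v > 0\<close> by (simp_all add: field_simps)
    have "u / v < real m" using \<open>u < 2 * pi\<close> mv \<open>v > 0\<close> by (simp add: divide_less_eq)
    with k have "k < m" by simp
    then have "real (Suc k) \<le> real m" by simp
    then have "real (Suc k) * v \<le> 2 * pi" unfolding mv[symmetric] using \<open>v > 0\<close>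
      by (intro mult_right_mono) auto
    then have "f (real k * v) \<le> f u" "f u \<le> f (real (Suc k) * v)"
      and "f (real k * v) = real k * f v" "f (real (Suc k) * v) = real (Suc k) * f v"
      using k' assms \<open>v > 0\<close> by (auto intro!: f_mono f_mult simp del: of_nat_Suc)
    then have "real k * v / 2 \<le> f u" "f u \<le> real k * v / 2 + v / 2"
      by (simp_all add: fv algebra_simps add_divide_distrib)
    moreover have "u / 2 \<le> real k * v / 2 + v / 2" "real k * v / 2 \<le> u / 2"
      using k' by (simp_all add: algebra_simps)
    ultimately have "\<bar>f u - u / 2\<bar> \<le> v / 2" unfolding abs_le_iff by linarith
    then show ?thesis by (simp add: v_def)
  qed
  have "(\<lambda>m. pi / real m) \<longlonglongrightarrow> 0" by (rule lim_const_over_n)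
  then have "\<bar>f u - u / 2\<bar> \<le> 0"
    using approx by (intro tendsto_lowerbound[of _ 0 sequentially]) (auto simp: eventually_sequentially intro!: exI[of _ 1])
  then show ?thesis by (simp add: f_def)
qed

lemma measure_circular_sector:
  assumes "0 \<le> r" "s \<le> t" "t \<le> s + 2 * pi"
  shows "measure lebesgue (polar_sector (\<lambda>_. r) s t) = r\<^sup>2 / 2 * (t - s)"
proof (cases "r = 0")
  case True
  have "polar_sector (\<lambda>_. 0) s t \<subseteq> {0}" by (auto simp: polar_sector_def)
  then have "negligible (polar_sector (\<lambda>_. 0) s t)" using negligible_subset negligible_sing by blast
  then show ?thesis using True by (simp add: negligible_imp_measure0)
next
  case False
  have "measure lebesgue (polar_sector (\<lambda>_. 1) (0 + s) ((t - s) + s)) = (t - s) / 2"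
    using assms by (subst measure_circular_sector_rotate) (auto simp: measure_unit_sector)
  then show ?thesis using measure_circular_sector_scale[of r s t] False assms by simp
qed

text \<open>A sector on which \<open>R\<^sup>2 / 2\<close> varies little lies between two circular sectors.\<close>

lemma measure_polar_sector_bounds:
  assumes R: "continuous_on {s..t} R" and nn: "\<And>\<theta>. \<theta> \<in> {s..t} \<Longrightarrow> 0 \<le> R \<theta>"
    and st: "s \<le> t" "t \<le> s + 2 * pi"
    and bd: "\<And>\<theta>. \<theta> \<in> {s..t} \<Longrightarrow> \<bar>(R \<theta>)\<^sup>2 / 2 - q\<bar> \<le> e"
  shows "\<bar>measure lebesgue (polar_sector R s t) - q * (t - s)\<bar> \<le> e * (t - s)"
proof -
  have mono: "measure lebesgue (polar_sector Q s t) \<le> measure lebesgue (polar_sector R s t)"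
    if "continuous_on {s..t} Q" "continuous_on {s..t} R"
      "\<And>\<theta>. \<theta> \<in> {s..t} \<Longrightarrow> 0 \<le> Q \<theta> \<and> Q \<theta> \<le> R \<theta>" for Q R
  proof (rule measure_mono_fmeasurable)
    show "polar_sector Q s t \<subseteq> polar_sector R s t"
      using that by (fastforce simp: polar_sector_def intro: order_trans)
    show "polar_sector Q s t \<in> sets lebesgue" "polar_sector R s t \<in> lmeasurable"
      using that order_trans[OF that(3)[THEN conjunct1] that(3)[THEN conjunct2]]
      by (auto intro!: fmeasurableD[OF lmeasurable_compact] lmeasurable_compact compact_polar_sector)
  qed
  \<comment> \<open>A negative lower bound \<open>q - e\<close> is replaced by the radius \<open>0\<close>.\<close>
  define m M where "m = sqrt (max 0 (2 * (q - e)))" and "M = sqrt (2 * (q + e))"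
  have "\<bar>(R s)\<^sup>2 / 2 - q\<bar> \<le> e" using st by (intro bd) simp
  then have qe: "0 \<le> q + e" using zero_le_power2[of "R s"] by linarith
  have mR: "m \<le> R \<theta>" and RM: "R \<theta> \<le> M" if "\<theta> \<in> {s..t}" for \<theta>
    unfolding m_def M_def using bd[OF that] nn[OF that]
    by (auto simp: abs_le_iff intro!: real_le_lsqrt real_le_rsqrt)
  have "(q - e) * (t - s) \<le> m\<^sup>2 / 2 * (t - s)"
    using st by (intro mult_right_mono) (auto simp: m_def)
  also have "\<dots> = measure lebesgue (polar_sector (\<lambda>_. m) s t)"
    using st by (subst measure_circular_sector) (auto simp: m_def)
  also have "\<dots> \<le> measure lebesgue (polar_sector R s t)"
    using mR R by (intro mono) (auto simp: m_def)
  finally have 1: "(q - e) * (t - s) \<le> measure lebesgue (polar_sector R s t)" .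
  have "measure lebesgue (polar_sector R s t) \<le> measure lebesgue (polar_sector (\<lambda>_. M) s t)"
    using RM R nn by (intro mono) auto
  also have "\<dots> = M\<^sup>2 / 2 * (t - s)"
    using st qe by (subst measure_circular_sector) (auto simp: M_def)
  also have "\<dots> = (q + e) * (t - s)" using qe by (simp add: M_def)
  finally show ?thesis using 1 by (simp add: abs_le_iff algebra_simps)
qed

text \<open>The area swept up to the angle \<open>x\<close> has derivative \<open>(R x)\<^sup>2 / 2\<close>: its increment over a
  short interval is squeezed by \<open>measure_polar_sector_bounds\<close>. The fundamental theorem of
  calculus does the rest.\<close>

theorem has_integral_measure_polar_sector:
  assumes R: "continuous_on {a..b} R" and nn: "\<And>\<theta>. \<theta> \<in> {a..b} \<Longrightarrow> 0 \<le> R \<theta>"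
    and ab: "a \<le> b" "b \<le> a + 2 * pi"
  shows "((\<lambda>\<theta>. (R \<theta>)\<^sup>2 / 2) has_integral measure lebesgue (polar_sector R a b)) {a..b}"
proof -
  define A where "A x = measure lebesgue (polar_sector R a x)" for x
  have diff: "A y - A x = measure lebesgue (polar_sector R x y)" if "a \<le> x" "x \<le> y" "y \<le> b" for x y
    using measure_polar_sector_split[OF continuous_on_subset[OF R], of a y x] that ab nn
    by (auto simp: A_def)
  have "(A has_vector_derivative (R x)\<^sup>2 / 2) (at x within {a..b})" if x: "x \<in> {a..b}" for x
    unfolding has_vector_derivative_def has_derivative_within_alt
  proof (intro conjI allI impI)
    show "bounded_linear (\<lambda>h. h *\<^sub>R ((R x)\<^sup>2 / 2))" by (rule bounded_linear_scaleR_left)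
    fix e :: real assume "e > 0"
    have "continuous_on {a..b} (\<lambda>\<theta>. (R \<theta>)\<^sup>2 / 2)" by (intro continuous_intros R) auto
    then obtain d where d: "d > 0"
      "\<And>y. y \<in> {a..b} \<Longrightarrow> dist y x < d \<Longrightarrow> dist ((R y)\<^sup>2 / 2) ((R x)\<^sup>2 / 2) < e"
      using x \<open>e > 0\<close> unfolding continuous_on_iff by meson
    show "\<exists>d>0. \<forall>y\<in>{a..b}. norm (y - x) < d \<longrightarrow>
        norm (A y - A x - (y - x) *\<^sub>R ((R x)\<^sup>2 / 2)) \<le> e * norm (y - x)"
    proof (intro exI[of _ d] conjI ballI impI)
      fix y assume y: "y \<in> {a..b}" "norm (y - x) < d"
      \<comment> \<open>The angle \<open>y\<close> may lie on either side of \<open>x\<close>.\<close>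
      define s t where "s = min x y" and "t = max x y"
      have st: "a \<le> s" "s \<le> t" "t \<le> b" using x y by (auto simp: s_def t_def)
      have "\<bar>measure lebesgue (polar_sector R s t) - (R x)\<^sup>2 / 2 * (t - s)\<bar> \<le> e * (t - s)"
      proof (rule measure_polar_sector_bounds)
        show "\<bar>(R \<theta>)\<^sup>2 / 2 - (R x)\<^sup>2 / 2\<bar> \<le> e" if "\<theta> \<in> {s..t}" for \<theta>
          using d(2)[of \<theta>] that st y by (auto simp: dist_real_def s_def t_def min_def max_def split: if_splits)
      qed (use st nn ab in \<open>auto intro: continuous_on_subset[OF R]\<close>)
      then have "\<bar>(A t - A s) - (R x)\<^sup>2 / 2 * (t - s)\<bar> \<le> e * (t - s)" by (simp add: diff[OF st])
      moreover have "(A y - A x - (y - x) *\<^sub>R ((R x)\<^sup>2 / 2)) =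
          (if x \<le> y then 1 else -1) * ((A t - A s) - (R x)\<^sup>2 / 2 * (t - s))"
        by (auto simp: s_def t_def algebra_simps)
      moreover have "\<bar>y - x\<bar> = t - s" by (auto simp: s_def t_def)
      ultimately show "norm (A y - A x - (y - x) *\<^sub>R ((R x)\<^sup>2 / 2)) \<le> e * norm (y - x)"
        by (simp only: real_norm_def abs_mult) simp
    qed (use d in simp)
  qed
  then have "((\<lambda>\<theta>. (R \<theta>)\<^sup>2 / 2) has_integral A b - A a) {a..b}"
    by (intro fundamental_theorem_of_calculus ab) auto
  moreover have "A a = 0" using diff[of a a] ab by (simp add: A_def)
  ultimately show ?thesis by (simp add: A_def)
qed


section \<open>The policle in polar coordinates\<close>

text \<open>The policle with the factor \<open>1 - (cos (n \<theta>))\<^sup>2 = (sin (n \<theta>))\<^sup>2\<close> cancelled from its equation by means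
  of the geometric sum. In this form the radius is visibly continuous and positive, and the limiting
  value at \<open>sin (n \<theta>) = 0\<close> is simply its value.\<close>

definition policle_radius :: "nat \<Rightarrow> real \<Rightarrow> real" where
  "policle_radius n \<theta> = root 4 (real n / (\<Sum>k<n. cos (real n * \<theta>) ^ (2 * k)))"

lemma sum_even_powers_ge_1:
  assumes "n \<ge> 1"
  shows "(\<Sum>k<n. (x :: real) ^ (2 * k)) \<ge> 1"
proof -
  have "(\<Sum>k\<in>{0}. x ^ (2 * k)) \<le> (\<Sum>k<n. x ^ (2 * k))"
    using assms by (intro sum_mono2) (auto simp: power_mult)
  then show ?thesis by simp
qed

lemma sum_even_powers_eq:
  fixes x :: real
  shows "(1 - x\<^sup>2) * (\<Sum>k<n. x ^ (2 * k)) = 1 - x ^ (2 * n)"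
  using one_diff_power_eq[of "x\<^sup>2" n] by (simp add: power_mult)

lemma policle_radius_pos: "n \<ge> 1 \<Longrightarrow> policle_radius n \<theta> > 0"
  using sum_even_powers_ge_1[of n "cos (real n * \<theta>)"] by (simp add: policle_radius_def)

lemma policle_radius_power4:
  assumes "n \<ge> 1"
  shows "policle_radius n \<theta> ^ 4 =
    (if sin (real n * \<theta>) = 0 then 1
     else real n * (sin (real n * \<theta>))\<^sup>2 / (1 - cos (real n * \<theta>) ^ (2 * n)))"
proof -
  define S where "S = (\<Sum>k<n. cos (real n * \<theta>) ^ (2 * k))"
  have "S \<ge> 1" using sum_even_powers_ge_1[OF assms] by (simp add: S_def)
  then have eq: "policle_radius n \<theta> ^ 4 = real n / S"
    by (simp add: policle_radius_def S_def[symmetric])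
  have S: "(sin (real n * \<theta>))\<^sup>2 * S = 1 - cos (real n * \<theta>) ^ (2 * n)"
    using sum_even_powers_eq[of "cos (real n * \<theta>)" n] by (simp add: S_def sin_squared_eq)
  show ?thesis
  proof (cases "sin (real n * \<theta>) = 0")
    case True
    then have "(cos (real n * \<theta>))\<^sup>2 = 1" using cos_squared_eq[of "real n * \<theta>"] by simp
    then have "S = real n" by (simp add: S_def power_mult)
    then show ?thesis using True eq assms by simp
  next
    case False
    then show ?thesis using eq by (simp flip: S)
  qed
qed

text \<open>The angle that witnesses membership in \<^const>\<open>policle\<close> may differ from \<^const>\<open>Arg\<close> by full
  turns; the radius does not see the difference because \<open>n\<close> is an integer.\<close>

lemma policle_radius_cis:
  assumes "cis \<theta> = cis \<phi>"
  shows "policle_radius n \<theta> = policle_radius n \<phi>"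
proof -
  have "cis (real n * \<theta>) = cis (real n * \<phi>)"
    using arg_cong[OF assms, of "\<lambda>z. z ^ n"] by (simp add: Complex.DeMoivre)
  then have "cos (real n * \<theta>) = cos (real n * \<phi>)" by (simp add: complex_eq_iff)
  then show ?thesis by (simp add: policle_radius_def)
qed

lemma rcis_policle_radius_in_policle:
  assumes "n \<ge> 1"
  shows "rcis (policle_radius n \<theta>) \<theta> \<in> policle n"
  unfolding policle_def using policle_radius_pos[OF assms] policle_radius_power4[OF assms]
  by (intro CollectI exI[of _ "policle_radius n \<theta>"] exI[of _ \<theta>]) (simp add: less_imp_le)

lemma policle_polar_form:
  assumes "n \<ge> 1" "w \<in> policle n"
  shows "w \<noteq> 0" and "w = rcis (policle_radius n (Arg w)) (Arg w)"
proof -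
  obtain r \<theta> where r: "w = rcis r \<theta>" "0 \<le> r" "r ^ 4 = policle_radius n \<theta> ^ 4"
    using assms(2) by (auto simp: policle_def policle_radius_power4[OF assms(1)])
  have pos: "policle_radius n \<theta> > 0" by (rule policle_radius_pos[OF assms(1)])
  then have rr: "r = policle_radius n \<theta>" using r(2,3) power_eq_imp_eq_base[of r 4 "policle_radius n \<theta>"] by simp
  show "w \<noteq> 0" using r rr pos by simp
  have w: "w = rcis r (Arg w)" using rcis_cmod_Arg[of w] r by simp
  then have "cis (Arg w) = cis \<theta>" using r rr pos by (simp add: rcis_def)
  then show "w = rcis (policle_radius n (Arg w)) (Arg w)"
    using w rr policle_radius_cis by metis
qed

lemma Arg_rcis_pos: "r > 0 \<Longrightarrow> - pi < \<theta> \<Longrightarrow> \<theta> \<le> pi \<Longrightarrow> Arg (rcis r \<theta>) = \<theta>"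
  by (rule cis_Arg_unique) (simp_all add: rcis_def sgn_mult sgn_of_real)

lemma policular_sector_eq_polar_sector:
  assumes "n \<ge> 1" "Arg B' = \<alpha>" "\<alpha> \<le> pi"
  shows "policular_sector n B' = polar_sector (policle_radius n) 0 \<alpha>"
proof (intro equalityI subsetI)
  fix z assume "z \<in> policular_sector n B'"
  then obtain w u where w: "w \<in> policle n" "0 \<le> Arg w" "Arg w \<le> \<alpha>" "0 \<le> u" "u \<le> 1" "z = u *\<^sub>R w"
    using assms by (auto simp: policular_sector_def in_segment)
  have "z = rcis (u * policle_radius n (Arg w)) (Arg w)"
    using policle_polar_form(2)[OF assms(1) w(1)] w(6)
    by (metis (no_types, lifting) mult.assoc of_real_mult rcis_def scaleR_conv_of_real)
  then show "z \<in> polar_sector (policle_radius n) 0 \<alpha>"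
    using w policle_radius_pos[OF assms(1), of "Arg w"] mult_left_le_one_le[of "policle_radius n (Arg w)" u]
    by (intro polar_sectorI[where r = "u * policle_radius n (Arg w)" and \<theta> = "Arg w"]) auto
next
  fix z assume "z \<in> polar_sector (policle_radius n) 0 \<alpha>"
  then obtain r \<theta> where z: "z = rcis r \<theta>" "0 \<le> \<theta>" "\<theta> \<le> \<alpha>" "0 \<le> r" "r \<le> policle_radius n \<theta>"
    by (blast elim: polar_sectorE)
  define w where "w = rcis (policle_radius n \<theta>) \<theta>"
  have pos: "policle_radius n \<theta> > 0" by (rule policle_radius_pos[OF assms(1)])
  have "Arg w = \<theta>" unfolding w_def using z assms pos pi_gt_zero by (intro Arg_rcis_pos) linarith+
  moreover have "z = (r / policle_radius n \<theta>) *\<^sub>R w"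
    using z pos by (simp add: w_def complex_eq_iff)
  moreover have "w \<in> policle n"
    unfolding w_def by (rule rcis_policle_radius_in_policle[OF assms(1)])
  moreover have "0 \<le> r / policle_radius n \<theta>" "r / policle_radius n \<theta> \<le> 1"
    using z pos by (auto simp: divide_le_eq)
  ultimately show "z \<in> policular_sector n B'"
    using z assms unfolding policular_sector_def in_segment
    by (intro CollectI bexI[of _ w] conjI exI[of _ "r / policle_radius n \<theta>"]) simp_all
qed

text \<open>This is \<open>sqrt n\<close> times the squared radius of the policle: the rate at which \<open>2 * a * sqrt n\<close>
  grows with the angle of \<open>B'\<close>.\<close>

definition sector_density :: "nat \<Rightarrow> real \<Rightarrow> real" where
  "sector_density n \<theta> = real n / sqrt (\<Sum>k<n. cos (real n * \<theta>) ^ (2 * k))"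

lemma continuous_on_sector_density: "n \<ge> 1 \<Longrightarrow> continuous_on A (sector_density n)"
  unfolding sector_density_def[abs_def]
  using order_less_le_trans[OF zero_less_one sum_even_powers_ge_1[of n]]
  by (intro continuous_intros) (auto simp: less_imp_neq[symmetric])

lemma policle_radius_square:
  assumes "n \<ge> 1"
  shows "2 * sqrt (real n) * ((policle_radius n \<theta>)\<^sup>2 / 2) = sector_density n \<theta>"
proof -
  define S where "S = (\<Sum>k<n. cos (real n * \<theta>) ^ (2 * k))"
  have "S > 0" using sum_even_powers_ge_1[OF assms, of "cos (real n * \<theta>)"] by (simp add: S_def)
  have "policle_radius n \<theta> = sqrt (sqrt (real n / S))"
    using real_root_mult_exp[of 2 2 "real n / S"] by (simp add: policle_radius_def S_def sqrt_def)
  then have "(policle_radius n \<theta>)\<^sup>2 = sqrt (real n) / sqrt S"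
    using \<open>S > 0\<close> by (simp add: real_sqrt_divide power_divide)
  then have "2 * sqrt (real n) * ((policle_radius n \<theta>)\<^sup>2 / 2) = (sqrt (real n) * sqrt (real n)) / sqrt S"
    by simp
  then show ?thesis by (simp add: sector_density_def S_def)
qed

lemma has_integral_policular_sector:
  assumes "n \<ge> 1" "Arg B' = \<alpha>" "0 \<le> \<alpha>" "\<alpha> \<le> pi"
  shows "(sector_density n has_integral 2 * measure lebesgue (policular_sector n B') * sqrt (real n)) {0..\<alpha>}"
proof -
  have "continuous_on {0..\<alpha>} (policle_radius n)"
    unfolding policle_radius_def[abs_def]
    using order_less_le_trans[OF zero_less_one sum_even_powers_ge_1[OF assms(1)]]
    by (intro continuous_intros) (auto simp: less_imp_neq[symmetric])
  then have "((\<lambda>\<theta>. (policle_radius n \<theta>)\<^sup>2 / 2) has_integral measure lebesgue (polar_sector (policle_radius n) 0 \<alpha>)) {0..\<alpha>}"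
    using assms less_imp_le[OF policle_radius_pos[OF assms(1)]] by (intro has_integral_measure_polar_sector) auto
  from has_integral_mult_right[OF this, of "2 * sqrt (real n)"] show ?thesis
    using assms by (simp only: policle_radius_square policular_sector_eq_polar_sector) (simp add: mult_ac)
qed

section \<open>The arc length of the sinusoidal spiral\<close>

text \<open>For \<open>\<theta>\<close> in the sector, the polar angle of \<open>B\<close> when \<open>C\<close> has polar angle \<open>\<theta>\<close>: the relation
  between \<open>B\<close> and \<open>C\<close>, solved for \<open>B\<close>.\<close>

definition policle_angle :: "nat \<Rightarrow> real \<Rightarrow> real" where
  "policle_angle n \<theta> = arccos (root n (cos (real n * \<theta>))) / real n"

lemma spiral_radius_derivative:
  assumes "n \<ge> 1" and c: "cos (real n * \<theta>) > 0"
  defines "\<rho> \<equiv> root n (cos (real n * \<theta>))"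
  shows "((\<lambda>\<theta>. root n (cos (real n * \<theta>))) has_real_derivative - sin (real n * \<theta>) / \<rho> ^ (n - 1)) (at \<theta>)"
proof -
  have "\<rho> > 0" using assms by simp
  have "((\<lambda>\<theta>. cos (real n * \<theta>)) has_real_derivative - (real n * sin (real n * \<theta>))) (at \<theta>)"
    by (auto intro!: derivative_eq_intros)
  from DERIV_chain2[OF DERIV_real_root[OF _ c, of n] this] show ?thesis
    using assms(1) \<open>\<rho> > 0\<close> by (simp add: \<rho>_def divide_simps)
qed

text \<open>With \<open>\<rho> ^ n = cos (n \<theta>)\<close>, the radial speed is \<open>- sin (n \<theta>) / \<rho> ^ (n - 1)\<close> and the angular one is
  \<open>\<rho> = cos (n \<theta>) / \<rho> ^ (n - 1)\<close>, so Pythagoras makes the sine and the cosine disappear.\<close>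

lemma spiral_derivative:
  assumes "n \<ge> 1" and c: "cos (real n * \<theta>) > 0"
  defines "\<rho> \<equiv> root n (cos (real n * \<theta>))"
  defines "v \<equiv> Complex (- sin (real n * \<theta>) / \<rho> ^ (n - 1)) \<rho> * cis \<theta>"
  shows "(spiral n has_vector_derivative v) (at \<theta>)" and "norm v = 1 / \<rho> ^ (n - 1)"
proof -
  have "\<rho> > 0" using assms by simp
  have 1: "((\<lambda>\<theta>. root n (cos (real n * \<theta>))) has_real_derivative - sin (real n * \<theta>) / \<rho> ^ (n - 1)) (at \<theta>)"
    unfolding \<rho>_def by (rule spiral_radius_derivative[OF assms(1,2)])
  have 2: "(cis has_vector_derivative \<i> * cis \<theta>) (at \<theta>)"
    unfolding has_vector_derivative_def by (auto intro!: derivative_eq_intros simp: scaleR_conv_of_real)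
  have "((\<lambda>\<theta>. root n (cos (real n * \<theta>)) *\<^sub>R cis \<theta>) has_vector_derivative
      \<rho> *\<^sub>R (\<i> * cis \<theta>) + (- sin (real n * \<theta>) / \<rho> ^ (n - 1)) *\<^sub>R cis \<theta>) (at \<theta>)"
    using has_vector_derivative_scaleR[OF 1 2] by (simp add: \<rho>_def)
  moreover have "spiral n = (\<lambda>\<theta>. root n (cos (real n * \<theta>)) *\<^sub>R cis \<theta>)"
    by (simp add: fun_eq_iff spiral_def rcis_def scaleR_conv_of_real)
  moreover have "\<rho> *\<^sub>R (\<i> * cis \<theta>) + (- sin (real n * \<theta>) / \<rho> ^ (n - 1)) *\<^sub>R cis \<theta> = v"
    by (simp add: v_def complex_eq_iff algebra_simps)
  ultimately show "(spiral n has_vector_derivative v) (at \<theta>)" by simp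
  have "\<rho> ^ n = cos (real n * \<theta>)" using assms by (simp add: \<rho>_def)
  moreover have "\<rho> ^ n = \<rho> * \<rho> ^ (n - 1)" using assms(1) by (cases n) auto
  ultimately have cos: "\<rho> = cos (real n * \<theta>) / \<rho> ^ (n - 1)" using \<open>\<rho> > 0\<close> by (simp add: divide_simps)
  have "(norm v)\<^sup>2 = (sin (real n * \<theta>) / \<rho> ^ (n - 1))\<^sup>2 + \<rho>\<^sup>2"
    by (simp add: v_def norm_mult cmod_power2)
  also have "\<dots> = (sin (real n * \<theta>) / \<rho> ^ (n - 1))\<^sup>2 + (cos (real n * \<theta>) / \<rho> ^ (n - 1))\<^sup>2"
    using cos by simp
  also have "\<dots> = (1 / \<rho> ^ (n - 1))\<^sup>2"
    unfolding power_divide add_divide_distrib[symmetric] by simp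
  finally show "norm v = 1 / \<rho> ^ (n - 1)"
    using \<open>\<rho> > 0\<close> by (simp add: power2_eq_iff_nonneg)
qed

text \<open>At the angle of \<open>B\<close> the cosine is \<open>\<rho>\<close>, and the geometric sum gives
  \<open>(1 - \<rho>\<^sup>2) * (\<Sum>k<n. \<rho> ^ (2 * k)) = 1 - \<rho> ^ (2 * n) = (sin (n \<theta>))\<^sup>2\<close>.\<close>

lemma sector_density_policle_angle:
  assumes "n \<ge> 1" and "0 < real n * \<theta>" "real n * \<theta> < pi / 2"
  defines "\<rho> \<equiv> root n (cos (real n * \<theta>))"
  shows "sector_density n (policle_angle n \<theta>) = real n * sqrt (1 - \<rho>\<^sup>2) / sin (real n * \<theta>)"
proof -
  have c: "0 < cos (real n * \<theta>)" "cos (real n * \<theta>) < 1"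
    using assms cos_gt_zero[of "real n * \<theta>"] cos_monotone_0_pi[of 0 "real n * \<theta>"] by auto
  have s: "sin (real n * \<theta>) > 0" using assms by (intro sin_gt_zero2) auto
  have \<rho>: "0 < \<rho>" "\<rho> < 1" using c assms(1) by (auto simp: \<rho>_def)
  define S where "S = (\<Sum>k<n. \<rho> ^ (2 * k))"
  have "S \<ge> 1" unfolding S_def by (rule sum_even_powers_ge_1[OF assms(1)])
  have "\<rho> ^ (2 * n) = (cos (real n * \<theta>))\<^sup>2"
    using c assms(1) by (simp add: \<rho>_def mult.commute[of 2] power_mult)
  then have "(1 - \<rho>\<^sup>2) * S = (sin (real n * \<theta>))\<^sup>2"
    using sum_even_powers_eq[of \<rho> n] by (simp add: S_def sin_squared_eq)
  then have "sqrt (1 - \<rho>\<^sup>2) * sqrt S = sin (real n * \<theta>)"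
    using s by (simp flip: real_sqrt_mult)
  moreover have "sector_density n (policle_angle n \<theta>) = real n / sqrt S"
    using assms(1) \<rho> by (simp add: sector_density_def policle_angle_def S_def \<rho>_def[symmetric])
  moreover have "sqrt S > 0" using \<open>S \<ge> 1\<close> by simp
  ultimately show ?thesis using s by (simp add: frac_eq_eq mult_ac)
qed

lemma policle_angle_bounds:
  assumes "n \<ge> 1" and "cos (real n * \<theta>) \<ge> 0"
  shows "policle_angle n \<theta> \<in> {0..pi / 2 / real n}"
proof -
  have "0 \<le> root n (cos (real n * \<theta>))" "root n (cos (real n * \<theta>)) \<le> 1"
    using assms by auto
  then show ?thesis
    unfolding policle_angle_def atLeastAtMost_iff
    by (intro conjI divide_right_mono divide_nonneg_nonneg arccos_lbound arccos_le_pi2) auto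
qed

text \<open>The right-hand side of the theorem, as a function of the polar angle of \<open>C\<close>.\<close>

definition spiral_length :: "nat \<Rightarrow> real \<Rightarrow> real" where
  "spiral_length n \<theta> = integral {0..policle_angle n \<theta>} (sector_density n)"

lemma policle_angle_derivative:
  assumes "n \<ge> 1" and "0 < real n * \<theta>" "real n * \<theta> < pi / 2"
  defines "\<rho> \<equiv> root n (cos (real n * \<theta>))"
  shows "(policle_angle n has_real_derivative
     sin (real n * \<theta>) / (real n * sqrt (1 - \<rho>\<^sup>2) * \<rho> ^ (n - 1))) (at \<theta>)"
proof -
  have c: "0 < cos (real n * \<theta>)" "cos (real n * \<theta>) < 1"
    using assms cos_gt_zero[of "real n * \<theta>"] cos_monotone_0_pi[of 0 "real n * \<theta>"] by auto
  have \<rho>: "0 < \<rho>" "\<rho> < 1" using c assms(1) by (auto simp: \<rho>_def)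
  have "(arccos has_real_derivative inverse (- sqrt (1 - \<rho>\<^sup>2))) (at \<rho>)"
    using \<rho> by (intro DERIV_arccos) auto
  from DERIV_cdivide[OF DERIV_chain2[OF this[unfolded \<rho>_def] spiral_radius_derivative[OF assms(1) c(1)]], of "real n"]
  show ?thesis
    unfolding policle_angle_def[abs_def] \<rho>_def by (simp add: divide_simps mult_ac)
qed

text \<open>The factor \<open>sqrt (1 - \<rho>\<^sup>2)\<close> from the derivative of \<^const>\<open>arccos\<close> cancels against the same factor in
  the density, and what remains is the speed of the spiral found in \<open>spiral_derivative\<close>.\<close>

lemma spiral_length_derivative:
  assumes "n \<ge> 1" and "0 < real n * \<theta>" "real n * \<theta> < pi / 2"
  shows "(spiral_length n has_real_derivative 1 / root n (cos (real n * \<theta>)) ^ (n - 1)) (at \<theta>)"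
proof -
  define \<rho> where "\<rho> = root n (cos (real n * \<theta>))"
  have c: "0 < cos (real n * \<theta>)" "cos (real n * \<theta>) < 1"
    using assms cos_gt_zero[of "real n * \<theta>"] cos_monotone_0_pi[of 0 "real n * \<theta>"] by auto
  have s: "sin (real n * \<theta>) > 0" using assms by (intro sin_gt_zero2) auto
  have \<rho>: "0 < \<rho>" "\<rho> < 1" using c assms(1) by (auto simp: \<rho>_def)
  define h where "h = policle_angle n \<theta>"
  have "arccos \<rho> > 0" using arccos_less_arccos[of \<rho> 1] \<rho> by simp
  then have "h > 0" using assms(1) by (simp add: h_def policle_angle_def \<rho>_def)
  have "h \<le> pi / 2 / real n" using policle_angle_bounds[OF assms(1), of \<theta>] c by (simp add: h_def)
  also have "\<dots> \<le> pi / 2 / 1" using assms(1) by (intro divide_left_mono) auto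
  also have "\<dots> < pi" by simp
  finally have "h < pi" .
  have "((\<lambda>x. integral {0..x} (sector_density n)) has_real_derivative sector_density n h) (at h within {0..pi})"
    using \<open>h > 0\<close> \<open>h < pi\<close> by (intro integral_has_real_derivative continuous_on_sector_density assms(1)) auto
  then have "((\<lambda>x. integral {0..x} (sector_density n)) has_real_derivative sector_density n h) (at h)"
    using \<open>h > 0\<close> \<open>h < pi\<close> by (simp add: at_within_Icc_at)
  from DERIV_chain2[OF this[unfolded h_def] policle_angle_derivative[OF assms]]
  have "(spiral_length n has_real_derivative
     sector_density n h * (sin (real n * \<theta>) / (real n * sqrt (1 - \<rho>\<^sup>2) * \<rho> ^ (n - 1)))) (at \<theta>)"
    unfolding spiral_length_def[abs_def] h_def \<rho>_def .
  moreover have "1 - \<rho>\<^sup>2 > 0" using \<rho> by (simp add: power_less_one_iff abs_square_less_1)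
  ultimately show ?thesis
    using s \<rho> assms(1) by (simp add: h_def sector_density_policle_angle[OF assms] flip: \<rho>_def)
qed

lemma continuous_on_spiral_length:
  assumes "n \<ge> 1" and "\<And>\<theta>. \<theta> \<in> A \<Longrightarrow> cos (real n * \<theta>) \<ge> 0"
  shows "continuous_on A (spiral_length n)"
proof -
  have angle: "continuous_on A (policle_angle n)"
    unfolding policle_angle_def[abs_def] using assms
    by (intro continuous_intros) (auto intro: order_trans[of _ 0])
  have area: "continuous_on {0..pi / 2 / real n} (\<lambda>x. integral {0..x} (sector_density n))"
    by (intro indefinite_integral_continuous_1 integrable_continuous_interval continuous_on_sector_density assms(1))
  show ?thesis
    unfolding spiral_length_def[abs_def]
    using continuous_on_compose2[OF area angle] policle_angle_bounds[OF assms(1)] assms(2) by blast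
qed

lemma curve_length_spiral:
  assumes n: "n \<ge> 1" and \<gamma>: "0 \<le> \<gamma>" "\<gamma> \<le> pi / (2 * real n)"
  shows "curve_length (spiral n) 0 \<gamma> = ennreal (integral {0..policle_angle n \<gamma>} (sector_density n))"
proof -
  have range: "0 \<le> real n * x" "real n * x \<le> pi / 2" if "x \<in> {0..\<gamma>}" for x
  proof -
    show "0 \<le> real n * x" using that by simp
    have "real n * x \<le> real n * (pi / (2 * real n))" using that \<gamma> by (intro mult_left_mono) auto
    also have "\<dots> = pi / 2" using n by simp
    finally show "real n * x \<le> pi / 2" .
  qed
  have range': "0 < real n * x" "real n * x < pi / 2" if "0 < x" "x < \<gamma>" for x
  proof -
    show "0 < real n * x" using that n by simp
    have "real n * x < real n * \<gamma>" using that n by simp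
    then show "real n * x < pi / 2" using range[of \<gamma>] \<gamma> by simp
  qed
  have nonneg: "cos (real n * x) \<ge> 0" if "x \<in> {0..\<gamma>}" for x
    using range[OF that] by (intro cos_ge_zero) auto
  have pos: "cos (real n * x) > 0" if "0 < x" "x < \<gamma>" for x
    using range'[OF that] by (intro cos_gt_zero) auto
  have "curve_length (spiral n) 0 \<gamma> = ennreal (spiral_length n \<gamma> - spiral_length n 0)"
  proof (rule curve_length_eq_antiderivative_of_speed)
    show "continuous_on {0..\<gamma>} (spiral n)"
      unfolding spiral_def[abs_def] by (intro continuous_intros)
    show "continuous_on {0..\<gamma>} (spiral_length n)"
      using nonneg by (intro continuous_on_spiral_length n)
    show "(spiral n has_vector_derivative
        Complex (- sin (real n * x) / root n (cos (real n * x)) ^ (n - 1)) (root n (cos (real n * x))) * cis x) (at x)"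
      if "0 < x" "x < \<gamma>" for x
      using that by (intro spiral_derivative n pos)
    show "(spiral_length n has_real_derivative
        norm (Complex (- sin (real n * x) / root n (cos (real n * x)) ^ (n - 1)) (root n (cos (real n * x))) * cis x)) (at x)"
      if "0 < x" "x < \<gamma>" for x
      unfolding spiral_derivative(2)[OF n pos[OF that]]
      using range'[OF that] by (intro spiral_length_derivative n)
  qed (use \<gamma> in simp)
  moreover have "spiral_length n 0 = 0"
    using n by (simp add: spiral_length_def policle_angle_def)
  ultimately show ?thesis by (simp add: spiral_length_def)
qed

theorem theorem12:
  fixes n :: nat and \<alpha> \<gamma> :: real and B B' C :: complex
  assumes "n \<ge> 1"
    and "0 \<le> \<alpha>" "\<alpha> \<le> pi / (2 * real n)" "B = spiral n \<alpha>"
    and "B' \<in> policle n" "B' = rcis (cmod B') \<alpha>"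
    and "0 \<le> \<gamma>" "\<gamma> \<le> pi / (2 * real n)" "C = spiral n \<gamma>"
    and "cmod C = cmod B ^ n"
  shows "curve_length (spiral n) 0 \<gamma> =
    ennreal (2 * measure lebesgue (policular_sector n B') * sqrt (real n))"
proof -
  have range: "0 \<le> real n * x \<and> real n * x \<le> pi / 2" if "0 \<le> x" "x \<le> pi / (2 * real n)" for x
    using that assms(1) by (simp add: field_simps)
  have nonneg: "0 \<le> cos (real n * x)" if "0 \<le> x" "x \<le> pi / (2 * real n)" for x
    using range[OF that] by (intro cos_ge_zero) auto
  have "cmod B ^ n = cos (real n * \<alpha>)"
    using assms(1,4) nonneg[OF assms(2,3)] by (simp add: spiral_def)
  moreover have "cmod C = root n (cos (real n * \<gamma>))"
    using assms(1,9) nonneg[OF assms(7,8)] by (simp add: spiral_def)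
  ultimately have "root n (cos (real n * \<gamma>)) = cos (real n * \<alpha>)"
    using assms(10) by simp
  moreover have "arccos (cos (real n * \<alpha>)) = real n * \<alpha>"
    using range[OF assms(2,3)] pi_gt_zero by (intro arccos_cos) linarith+
  ultimately have "policle_angle n \<gamma> = \<alpha>"
    using assms(1) by (simp add: policle_angle_def)
  moreover have "\<alpha> \<le> pi"
  proof -
    have "\<alpha> \<le> real n * \<alpha>" using assms(1,2) by (simp add: mult_le_cancel_right1)
    then show ?thesis using range[OF assms(2,3)] by linarith
  qed
  moreover have "Arg B' = \<alpha>"
  proof -
    have "cmod B' > 0" using policle_polar_form(1)[OF assms(1,5)] by simp
    then have "Arg (rcis (cmod B') \<alpha>) = \<alpha>"
      using \<open>\<alpha> \<le> pi\<close> assms(2) pi_gt_zero by (intro Arg_rcis_pos) linarith+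
    then show ?thesis using assms(6) by simp
  qed
  ultimately show ?thesis
    using curve_length_spiral[OF assms(1,7,8)]
      integral_unique[OF has_integral_policular_sector[OF assms(1) _ assms(2)]] by simp
qed

end
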